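(* Let $P$ be an $n\times n$ stochastic matrix, irreducible, on a finite state space $\mathcal X$ with $|\mathcal X|=n$, with stationary distribution $\pi$ satisfying $\pi(x)>0$ for all $x\in\mathcal X$. Let $M_1,M_2$ be the first and second Metropolis-Hastings (MH) kernels of $P$, and let $\gamma(P)$ be the (right) spectral gap of $P$. Then $$1-\tfrac12 U\le \gamma(P)\le 1-\tfrac12 L,$$ where $$L:=\max_{l+m=2+n}\{\lambda_l(M_1)+\lambda_m(M_2)\},\qquad U:=\min_{j+k=3}\{\lambda_j(M_1)+\lambda_k(M_2)\},$$ the indices $l,m,j,k$ ranging over $\{1,\dots,n\}$.
   Context: For a self-adjoint matrix $K$ on $l^2(\pi)$ (inner product $\langle f,g\rangle_\pi=\sum_x f(x)\overline{g(x)}\pi(x)$), $\lambda_1(K)\ge\dots\ge\lambda_n(K)$ are its eigenvalues. The adjoint (time-reversal) of $P$ is $P^*(x,y)=\pi(y)P(y,x)/\pi(x)$. For finite chains the spectral gap is $\gamma(P)=\gamma((P+P^* )/2)=1-\lambda_2((P+P^* )/2)$. The first and second MH kernels are given, for $x\ne y$, by $$M_1(x,y)=\min\{P(x,y),P^*(x,y)\},\qquad M_2(x,y)=\max\{P(x,y),P^*(x,y)\},$$ and on the diagonal by $M_1(x,x)=P(x,x)+r_1(x)$, $M_2(x,x)=P(x,x)-r_1(x)$, where $r_1(x)=\sum_{y\ne x}\bigl(P(x,y)-\min\{P(x,y),P^*(x,y)\}\bigr)$. Both are self-adjoint on $l^2(\pi)$. *)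

theory Defs
  imports "HOL-Analysis.Analysis" "HOL-Library.Multiset"
begin

text \<open>
  Matrices indexed by the finite state space \<open>'x\<close> act on functions by
  \<open>(K f)(x) = (\<Sum>y. K(x,y) f(y))\<close>, which is \<^term>\<open>K *v f\<close>.
\<close>

definition stochastic :: "real^'x^'x \<Rightarrow> bool" where
  "stochastic P \<longleftrightarrow> (\<forall>x y. 0 \<le> P $ x $ y) \<and> (\<forall>x. (\<Sum>y\<in>UNIV. P $ x $ y) = 1)"

definition mat_power :: "real^'x^'x \<Rightarrow> nat \<Rightarrow> real^'x^'x" where
  "mat_power P k = (((**) P) ^^ k) (mat 1)"

definition irreducible_chain :: "real^'x^'x \<Rightarrow> bool" where
  "irreducible_chain P \<longleftrightarrow> (\<forall>x y. \<exists>k. mat_power P k $ x $ y > 0)"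

definition stationary_distribution :: "real^'x \<Rightarrow> real^'x^'x \<Rightarrow> bool" where
  "stationary_distribution \<pi> P \<longleftrightarrow>
     (\<forall>x. 0 \<le> \<pi> $ x) \<and> (\<Sum>x\<in>UNIV. \<pi> $ x) = 1 \<and> \<pi> v* P = \<pi>"

definition time_reversal :: "real^'x \<Rightarrow> real^'x^'x \<Rightarrow> real^'x^'x" where
  "time_reversal \<pi> P = (\<chi> x y. \<pi> $ y * P $ y $ x / \<pi> $ x)"

definition MH_rejection :: "real^'x \<Rightarrow> real^'x^'x \<Rightarrow> 'x \<Rightarrow> real" where
  "MH_rejection \<pi> P x =
     (\<Sum>y\<in>UNIV - {x}. P $ x $ y - min (P $ x $ y) (time_reversal \<pi> P $ x $ y))"

definition MH1 :: "real^'x \<Rightarrow> real^'x^'x \<Rightarrow> real^'x^'x" where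
  "MH1 \<pi> P = (\<chi> x y. if x = y then P $ x $ x + MH_rejection \<pi> P x
                     else min (P $ x $ y) (time_reversal \<pi> P $ x $ y))"

definition MH2 :: "real^'x \<Rightarrow> real^'x^'x \<Rightarrow> real^'x^'x" where
  "MH2 \<pi> P = (\<chi> x y. if x = y then P $ x $ x - MH_rejection \<pi> P x
                     else max (P $ x $ y) (time_reversal \<pi> P $ x $ y))"

definition additive_reversibilization :: "real^'x \<Rightarrow> real^'x^'x \<Rightarrow> real^'x^'x" where
  "additive_reversibilization \<pi> P = (1/2) *\<^sub>R (P + time_reversal \<pi> P)"

definition l2_inner :: "real^'x \<Rightarrow> real^'x \<Rightarrow> real^'x \<Rightarrow> real" where
  "l2_inner \<pi> f g = (\<Sum>x\<in>UNIV. f $ x * g $ x * \<pi> $ x)"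

definition self_adjoint :: "real^'x \<Rightarrow> real^'x^'x \<Rightarrow> bool" where
  "self_adjoint \<pi> K \<longleftrightarrow> (\<forall>f g. l2_inner \<pi> (K *v f) g = l2_inner \<pi> f (K *v g))"

definition eigenspace :: "real^'x^'x \<Rightarrow> real \<Rightarrow> (real^'x) set" where
  "eigenspace K t = {f. K *v f = t *\<^sub>R f}"

definition eigenvalues :: "real^'x^'x \<Rightarrow> real set" where
  "eigenvalues K = {t. \<exists>f. f \<noteq> 0 \<and> K *v f = t *\<^sub>R f}"

text \<open>
  The real eigenvalues in decreasing order, each repeated according to the dimension of its
  eigenspace. For matrices that are self-adjoint on \<open>l\<^sup>2(\<pi>)\<close> with \<open>\<pi> > 0\<close> (the only ones to
  which this is applied) these are all the eigenvalues, geometric and algebraic multiplicities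
  agree, and the list has length \<^term>\<open>CARD('x)\<close>.
\<close>

definition eigenvalue_list :: "real^'x^'x \<Rightarrow> real list" where
  "eigenvalue_list K =
     rev (sorted_list_of_multiset (\<Sum>t\<in>eigenvalues K. replicate_mset (dim (eigenspace K t)) t))"

text \<open>Indices start at 1: \<open>ev K 1\<close> is the largest eigenvalue.\<close>

definition ev :: "real^'x^'x \<Rightarrow> nat \<Rightarrow> real" where
  "ev K k = eigenvalue_list K ! (k - 1)"

definition spectral_gap :: "real^'x \<Rightarrow> real^'x^'x \<Rightarrow> real" where
  "spectral_gap \<pi> P = 1 - ev (additive_reversibilization \<pi> P) 2"

text \<open>
  The kernels whose spectra are used are indeed self-adjoint; detailed balance suffices.
\<close>

lemma self_adjointI:
  fixes \<pi> :: "real^'x" and K :: "real^'x^'x"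
  assumes "\<And>x y. \<pi> $ x * K $ x $ y = \<pi> $ y * K $ y $ x"
  shows "self_adjoint \<pi> K"
  unfolding self_adjoint_def
proof (intro allI)
  fix f g :: "real^'x"
  have "l2_inner \<pi> (K *v f) g = (\<Sum>x\<in>UNIV. \<Sum>y\<in>UNIV. (\<pi> $ x * K $ x $ y) * (f $ y * g $ x))"
    by (simp add: l2_inner_def matrix_vector_mult_def sum_distrib_left sum_distrib_right mult_ac)
  also have "\<dots> = (\<Sum>x\<in>UNIV. \<Sum>y\<in>UNIV. (\<pi> $ y * K $ y $ x) * (f $ y * g $ x))"
    using assms by simp
  also have "\<dots> = (\<Sum>y\<in>UNIV. \<Sum>x\<in>UNIV. (\<pi> $ y * K $ y $ x) * (f $ y * g $ x))"
    by (rule sum.swap)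
  also have "\<dots> = l2_inner \<pi> f (K *v g)"
    by (simp add: l2_inner_def matrix_vector_mult_def sum_distrib_left sum_distrib_right mult_ac)
  finally show "l2_inner \<pi> (K *v f) g = l2_inner \<pi> f (K *v g)" .
qed

lemma self_adjoint_kernels:
  fixes \<pi> :: "real^'x" and P :: "real^'x^'x"
  assumes "\<And>x. \<pi> $ x > 0"
  shows "self_adjoint \<pi> (MH1 \<pi> P)" "self_adjoint \<pi> (MH2 \<pi> P)"
    "self_adjoint \<pi> (additive_reversibilization \<pi> P)"
proof -
  have nz: "\<pi> $ x \<noteq> 0" for x using assms[of x] by simp
  have mul: "\<pi> $ x * min a b = min (\<pi> $ x * a) (\<pi> $ x * b)"
       "\<pi> $ x * max a b = max (\<pi> $ x * a) (\<pi> $ x * b)" for x a b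
    using assms[of x] by (simp_all add: min_mult_distrib_left max_mult_distrib_left)
  show "self_adjoint \<pi> (MH1 \<pi> P)"
    by (rule self_adjointI) (simp add: MH1_def mul time_reversal_def nz min.commute)
  show "self_adjoint \<pi> (MH2 \<pi> P)"
    by (rule self_adjointI) (simp add: MH2_def mul time_reversal_def nz max.commute)
  show "self_adjoint \<pi> (additive_reversibilization \<pi> P)"
    by (rule self_adjointI) (simp add: additive_reversibilization_def time_reversal_def nz field_simps)
qed

end

theory Submission
  imports Defs
begin

text \<open>
  Off the diagonal, \<open>min a b + max a b = a + b\<close>; on the diagonal the rejection mass added to
  \<^term>\<open>MH1 \<pi> P\<close> is subtracted from \<^term>\<open>MH2 \<pi> P\<close>, leaving twice the
  diagonal of \<open>P\<close>, which \<open>P\<^sup>*\<close> shares. Hence \<open>M\<^sub>1 + M\<^sub>2 = P + P\<^sup>*\<close>, which is twice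
  the additive reversibilization (\<open>MH1_add_MH2\<close>), and the spectral gap is
  \<open>1 - \<lambda>\<^sub>2(M\<^sub>1 + M\<^sub>2) / 2\<close>. Both bounds are then Weyl's inequalities for the
  second eigenvalue of a sum of two self-adjoint matrices,
  \<open>\<lambda>\<^sub>j\<^sub>+\<^sub>k\<^sub>-\<^sub>1(A + B) \<le> \<lambda>\<^sub>j(A) + \<lambda>\<^sub>k(B)\<close> and \<open>\<lambda>\<^sub>l(A) + \<lambda>\<^sub>m(B) \<le> \<lambda>\<^sub>l\<^sub>+\<^sub>m\<^sub>-\<^sub>n(A + B)\<close>,
  taken at \<open>j + k - 1 = 2\<close> and \<open>l + m - n = 2\<close> (\<open>Weyl_upper\<close>, \<open>Weyl_lower\<close>).

  Weyl's inequalities come from a dimension count. The span of the eigenvectors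
  with eigenvalue at least \<open>\<lambda>\<^sub>k(K)\<close> has dimension at least \<open>k\<close>, the one with eigenvalue at most
  \<open>\<lambda>\<^sub>k(K)\<close> has dimension at least \<open>n + 1 - k\<close>, and on them the quadratic form
  \<open>\<langle>Kf, f\<rangle>\<close> is bounded below, respectively above, by \<open>\<lambda>\<^sub>k(K) \<langle>f, f\<rangle>\<close>. Three such subspaces, one for
  each of \<open>A\<close>, \<open>B\<close> and \<open>A + B\<close>, have dimensions adding up to more than \<open>2n\<close>, so they
  share a nonzero vector, and comparing the three forms there gives the inequality.

  The span dimensions rest on the spectral theorem, obtained for symmetric operators on a
  Euclidean space by maximizing the Rayleigh quotient (\<open>orthonormal_eigenbasis\<close>)
  and carried over to \<open>l\<^sup>2(\<pi>)\<close> by the isometry that multiplies a function by \<open>\<surd>\<pi>\<close>.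
\<close>

section \<open>The spectral theorem on a Euclidean space\<close>

text \<open>
  A maximizer \<open>x\<close> of \<open>\<langle>Tf, f\<rangle>\<close> on the unit sphere of \<open>V\<close> is an eigenvector. With the maximum
  \<open>m\<close>, the form \<open>q(y) = m \<langle>y, y\<rangle> - \<langle>Ty, y\<rangle>\<close> is nonnegative on \<open>V\<close> and vanishes at \<open>x\<close>;
  moving from \<open>x\<close> along \<open>v = m x - T x\<close> changes \<open>q\<close> to first order by \<open>-2\<close> times
  \<open>\<langle>v, v\<rangle>\<close>, so \<open>v\<close> must be zero.
\<close>

lemma Rayleigh_maximum_eigenvector:
  fixes T :: "'a::euclidean_space \<Rightarrow> 'a"
  assumes T: "linear T" and sym: "\<And>f g. T f \<bullet> g = f \<bullet> T g"
    and V: "subspace V" and inv: "\<And>f. f \<in> V \<Longrightarrow> T f \<in> V" and nz: "V \<noteq> {0}"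
  obtains x m where "x \<in> V" "norm x = 1" "T x = m *\<^sub>R x"
proof -
  let ?S = "V \<inter> sphere 0 1"
  have "compact ?S"
    using V by (intro closed_Int_compact closed_subspace) auto
  moreover have "?S \<noteq> {}"
  proof -
    obtain y where "y \<in> V" "y \<noteq> 0"
      using nz subspace_0[OF V] by blast
    then have "(1 / norm y) *\<^sub>R y \<in> ?S"
      using subspace_scale[OF V] by auto
    then show ?thesis by blast
  qed
  moreover have "continuous_on ?S (\<lambda>f. T f \<bullet> f)"
    by (intro continuous_intros linear_continuous_on T[unfolded linear_conv_bounded_linear])
  ultimately obtain x where x: "x \<in> ?S" and max: "\<And>y. y \<in> ?S \<Longrightarrow> T y \<bullet> y \<le> T x \<bullet> x"
    using continuous_attains_sup[of ?S "\<lambda>f. T f \<bullet> f"] by blast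
  define m where "m = T x \<bullet> x"
  have xV: "x \<in> V" and x1: "norm x = 1" using x by auto
  define q where "q y = m * (y \<bullet> y) - T y \<bullet> y" for y
  have q_nonneg: "0 \<le> q y" if y: "y \<in> V" for y
  proof (cases "y = 0")
    case False
    then have "(1 / norm y) *\<^sub>R y \<in> ?S"
      using subspace_scale[OF V] y by auto
    from max[OF this] False show ?thesis
      by (simp add: q_def m_def linear_cmul[OF T] divide_simps dot_square_norm power2_eq_square mult_ac)
  qed (simp add: q_def linear_0[OF T])
  define v where "v = m *\<^sub>R x - T x"
  have vV: "v \<in> V"
    unfolding v_def by (intro subspace_diff V subspace_scale inv xV)
  have expand: "q (x - s *\<^sub>R v) = s\<^sup>2 * q v - 2 * s * (v \<bullet> v)" for s
  proof -
    have "T v \<bullet> x = T x \<bullet> v" "x \<bullet> T v = T x \<bullet> v" "v \<bullet> T x = T x \<bullet> v"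
      by (metis sym inner_commute)+
    moreover have "x \<bullet> x = 1" using x1 by (simp add: dot_square_norm)
    ultimately have "q (x - s *\<^sub>R v) = s\<^sup>2 * q v - 2 * s * (m * (x \<bullet> v) - T x \<bullet> v)"
      by (simp add: q_def linear_diff[OF T] linear_cmul[OF T] inner_diff_left inner_diff_right
          inner_commute[of v x] algebra_simps power2_eq_square flip: m_def)
    moreover have "v \<bullet> v = m * (x \<bullet> v) - T x \<bullet> v"
      by (metis v_def inner_diff_left inner_scaleR_left)
    ultimately show ?thesis by simp
  qed
  have "v \<bullet> v = 0"
  proof (rule ccontr)
    assume "v \<bullet> v \<noteq> 0"
    then have pos: "v \<bullet> v > 0" by simp
    (* Any s > 0 with s * q v < 2 * (v \<bullet> v) makes q negative; the 1 covers the case q v = 0. *)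
    define s where "s = (v \<bullet> v) / (1 + q v)"
    have qv: "q v \<ge> 0" by (rule q_nonneg[OF vV])
    have s: "s > 0" "s * (1 + q v) = v \<bullet> v"
      using pos qv by (auto simp: s_def)
    have "0 \<le> q (x - s *\<^sub>R v)"
      by (intro q_nonneg subspace_diff V xV subspace_scale vV)
    then have "0 \<le> s * (s * q v - 2 * (v \<bullet> v))"
      by (simp add: expand power2_eq_square algebra_simps)
    then have "2 * (v \<bullet> v) \<le> s * q v"
      using s(1) by (simp add: zero_le_mult_iff)
    also have "\<dots> < v \<bullet> v"
      using s by (simp add: algebra_simps)
    finally show False using pos by simp
  qed
  then have "T x = m *\<^sub>R x" by (simp add: v_def)
  with xV x1 show ?thesis by (rule that)
qed

text \<open>
  Induction on the dimension: split off one eigenvector; by symmetry its orthogonal complement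
  in \<open>V\<close> is again invariant.
\<close>

lemma orthonormal_eigenbasis:
  fixes T :: "'a::euclidean_space \<Rightarrow> 'a"
  assumes T: "linear T" and sym: "\<And>f g. T f \<bullet> g = f \<bullet> T g"
    and "subspace V" and "\<And>f. f \<in> V \<Longrightarrow> T f \<in> V"
  shows "\<exists>B \<mu>. pairwise orthogonal B \<and> (\<forall>b\<in>B. norm b = 1 \<and> T b = \<mu> b *\<^sub>R b) \<and> span B = V"
  using assms(3,4)
proof (induction "dim V" arbitrary: V rule: less_induct)
  case less
  note V = less.prems(1) and inv = less.prems(2)
  show ?case
  proof (cases "V = {0}")
    case True
    then show ?thesis by (intro exI[of _ "{}"]) simp
  next
    case False
    obtain x m where x: "x \<in> V" "norm x = 1" "T x = m *\<^sub>R x"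
      using Rayleigh_maximum_eigenvector[OF T sym V inv False] by blast
    define W where "W = {y \<in> V. x \<bullet> y = 0}"
    have W: "subspace W"
      unfolding W_def using V by (auto simp: subspace_def inner_add_right)
    have WV: "W \<subseteq> V" by (auto simp: W_def)
    have xW: "x \<notin> W" using x(2) by (auto simp: W_def)
    have "T f \<in> W" if "f \<in> W" for f
      using that inv x(3) by (auto simp: W_def simp flip: sym)
    moreover have "dim W < dim V"
      using WV xW x(1) by (intro dim_psubset) (metis V W psubsetI span_eq_iff)
    ultimately obtain B \<mu> where orth: "pairwise orthogonal B"
      and B: "\<And>b. b \<in> B \<Longrightarrow> norm b = 1 \<and> T b = \<mu> b *\<^sub>R b" and sp: "span B = W"
      using less.hyps[of W] W by blast
    have BW: "B \<subseteq> W" using sp span_superset by blast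
    have "pairwise orthogonal (insert x B)"
      using orth BW by (auto simp: pairwise_insert orthogonal_def W_def inner_commute)
    moreover have "\<forall>b\<in>insert x B. norm b = 1 \<and> T b = (\<mu>(x := m)) b *\<^sub>R b"
      using x B BW xW by auto
    moreover have "span (insert x B) = V"
    proof
      show "span (insert x B) \<subseteq> V"
        using V BW WV x(1) by (intro span_minimal) auto
      show "V \<subseteq> span (insert x B)"
      proof
        fix y assume "y \<in> V"
        then have "y - (x \<bullet> y) *\<^sub>R x \<in> span B"
          using x V by (simp add: sp W_def subspace_diff subspace_scale inner_diff_right dot_square_norm)
        then show "y \<in> span (insert x B)"
          unfolding span_insert by blast
      qed
    qed
    ultimately show ?thesis by blast
  qed
qed

section \<open>Orthonormal eigenbases in weighted l2\<close>

text \<open>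
  The eigenvalue of each basis vector is recorded by a function \<open>\<mu>\<close>, so that repeated eigenvalues
  are counted by the vectors of the basis rather than by dimensions of eigenspaces.
\<close>

locale eigenbasis =
  fixes \<pi> :: "real^'x" and K :: "real^'x^'x" and C :: "(real^'x) set" and \<mu> :: "real^'x \<Rightarrow> real"
  assumes indep: "independent C" and spans: "span C = UNIV"
    and eigen: "\<And>c. c \<in> C \<Longrightarrow> K *v c = \<mu> c *\<^sub>R c"
    and orthonormal: "\<And>c d. c \<in> C \<Longrightarrow> d \<in> C \<Longrightarrow> l2_inner \<pi> c d = (if c = d then 1 else 0)"

text \<open>
  Multiplication by \<open>\<surd>\<pi>\<close> (the map \<open>D\<close> below, with inverse \<open>E\<close>) is an isometry from \<open>l\<^sup>2(\<pi>)\<close>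
  to Euclidean space. It turns \<open>K\<close> into the symmetric operator \<open>D K E\<close>, and \<open>E\<close> carries an
  orthonormal eigenbasis of that operator back to one of \<open>K\<close>.
\<close>

lemma self_adjoint_eigenbasis:
  fixes \<pi> :: "real^'x" and K :: "real^'x^'x"
  assumes pos: "\<And>x. \<pi> $ x > 0" and sa: "self_adjoint \<pi> K"
  obtains C \<mu> where "eigenbasis \<pi> K C \<mu>"
proof -
  define D :: "real^'x \<Rightarrow> real^'x" where "D f = (\<chi> x. sqrt (\<pi> $ x) * f $ x)" for f
  define E :: "real^'x \<Rightarrow> real^'x" where "E f = (\<chi> x. f $ x / sqrt (\<pi> $ x))" for f
  have nz: "\<pi> $ x \<noteq> 0" "\<pi> $ x \<ge> 0" for x using pos[of x] by simp_all
  have DE: "D (E f) = f" and ED: "E (D f) = f" for f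
    by (simp_all add: D_def E_def vec_eq_iff nz)
  have linD: "linear D" and linE: "linear E"
    by (auto intro!: linearI simp: D_def E_def vec_eq_iff algebra_simps add_divide_distrib)
  have inner: "l2_inner \<pi> (E f) (E g) = f \<bullet> g" for f g
    by (auto simp: l2_inner_def inner_vec_def E_def nz intro!: sum.cong)
  define T where "T f = D (K *v E f)" for f
  have linT: "linear T"
    unfolding T_def using linear_compose[OF linE linear_compose[OF matrix_vector_mul_linear[of K] linD]]
    by (simp add: o_def)
  have sym: "T f \<bullet> g = f \<bullet> T g" for f g
    using sa by (simp add: T_def ED self_adjoint_def flip: inner)
  obtain B \<mu> where orth: "pairwise orthogonal B"
    and B: "\<And>b. b \<in> B \<Longrightarrow> norm b = 1 \<and> T b = \<mu> b *\<^sub>R b" and sp: "span B = UNIV"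
    using orthonormal_eigenbasis[OF linT sym subspace_UNIV] by blast
  have injE: "inj E" by (rule inj_on_inverseI[of _ D]) (simp add: DE)
  have "0 \<notin> B" using B by force
  then have "independent B" by (rule pairwise_orthogonal_independent[OF orth])
  then have "independent (E ` B)"
    by (intro linear_independent_injective_image linE) (use injE in \<open>auto intro: inj_on_subset\<close>)
  moreover have "span (E ` B) = UNIV"
    by (metis DE ED linE linear_span_image sp surjI)
  moreover have "K *v c = \<mu> (D c) *\<^sub>R c" if "c \<in> E ` B" for c
    using that B by (metis (no_types, lifting) DE ED T_def imageE linE linear_cmul)
  moreover have "l2_inner \<pi> c d = (if c = d then 1 else 0)" if "c \<in> E ` B" "d \<in> E ` B" for c d
  proof -
    obtain b b' where "b \<in> B" "b' \<in> B" "c = E b" "d = E b'"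
      using \<open>c \<in> E ` B\<close> \<open>d \<in> E ` B\<close> by blast
    then show ?thesis
      using B orth injE
      by (auto simp: inner pairwise_def orthogonal_def dot_square_norm inj_eq)
  qed
  ultimately have "eigenbasis \<pi> K (E ` B) (\<lambda>c. \<mu> (D c))"
    by unfold_locales
  then show ?thesis by (rule that)
qed

lemma l2_inner_commute: "l2_inner \<pi> f g = l2_inner \<pi> g f"
  by (simp add: l2_inner_def mult_ac)

lemma l2_inner_add_left: "l2_inner \<pi> (f + g) h = l2_inner \<pi> f h + l2_inner \<pi> g h"
  by (simp add: l2_inner_def algebra_simps sum.distrib)

lemma l2_inner_scaleR_left: "l2_inner \<pi> (a *\<^sub>R f) g = a * l2_inner \<pi> f g"
  by (simp add: l2_inner_def sum_distrib_left mult_ac)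

lemma l2_inner_sum_left: "l2_inner \<pi> (\<Sum>i\<in>I. F i) g = (\<Sum>i\<in>I. l2_inner \<pi> (F i) g)"
  by (induction I rule: infinite_finite_induct) (auto simp: l2_inner_add_left, auto simp: l2_inner_def)

lemma l2_inner_pos:
  assumes "\<And>x. \<pi> $ x > 0" "f \<noteq> 0"
  shows "l2_inner \<pi> f f > 0"
proof -
  obtain x where "f $ x \<noteq> 0" using assms(2) by (auto simp: vec_eq_iff)
  then have "f $ x * f $ x * \<pi> $ x > 0"
    using assms(1)[of x] by (metis mult_pos_pos not_real_square_gt_zero)
  then show ?thesis
    unfolding l2_inner_def
    by (intro sum_pos2[of _ x]) (auto intro!: mult_nonneg_nonneg[OF zero_le_square] less_imp_le[OF assms(1)])
qed

lemma sum_mset_replicate_fibres: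
  assumes "finite C"
  shows "(\<Sum>t\<in>\<mu> ` C. replicate_mset (card {c\<in>C. \<mu> c = t}) t) = image_mset \<mu> (mset_set C)"
proof (rule multiset_eqI)
  fix s
  have "count (\<Sum>t\<in>\<mu> ` C. replicate_mset (card {c\<in>C. \<mu> c = t}) t) s
      = (\<Sum>t\<in>\<mu> ` C. if t = s then card {c\<in>C. \<mu> c = s} else 0)"
    by (auto simp: count_sum intro!: sum.cong)
  also have "\<dots> = card {c\<in>C. \<mu> c = s}"
    using assms by (auto simp: sum.delta)
  also have "\<dots> = count (image_mset \<mu> (mset_set C)) s"
  proof -
    have "card {c\<in>C. \<mu> c = s} = (\<Sum>c | c \<in># mset_set C \<and> s = \<mu> c. count (mset_set C) c)"
      unfolding card_eq_sum using assms by (intro sum.cong) auto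
    then show ?thesis by (simp only: count_image_mset')
  qed
  finally show "count (\<Sum>t\<in>\<mu> ` C. replicate_mset (card {c\<in>C. \<mu> c = t}) t) s
      = count (image_mset \<mu> (mset_set C)) s" .
qed

section \<open>Eigenvalues and quadratic form in an eigenbasis\<close>

context eigenbasis
begin

lemma finite_basis: "finite C"
  by (rule independent_imp_finite[OF indep])

lemma card_basis: "card C = CARD('x)"
  using dim_eq_card_independent[OF indep] dim_span[of C] by (simp add: spans)

lemma expansion: "f = (\<Sum>c\<in>C. l2_inner \<pi> f c *\<^sub>R c)"
proof -
  obtain u where u: "f = (\<Sum>c\<in>C. u c *\<^sub>R c)"
    using spans unfolding span_finite[OF finite_basis] by blast
  have "l2_inner \<pi> f d = u d" if "d \<in> C" for d
  proof -
    have "l2_inner \<pi> f d = (\<Sum>c\<in>C. if c = d then u d else 0)"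
      unfolding u l2_inner_sum_left using that
      by (intro sum.cong) (auto simp: l2_inner_scaleR_left orthonormal)
    then show ?thesis using that finite_basis by simp
  qed
  then show ?thesis by (simp add: u)
qed

lemma mult_expansion: "K *v f = (\<Sum>c\<in>C. (\<mu> c * l2_inner \<pi> f c) *\<^sub>R c)"
proof -
  have "K *v f = K *v (\<Sum>c\<in>C. l2_inner \<pi> f c *\<^sub>R c)"
    by (simp flip: expansion)
  also have "\<dots> = (\<Sum>c\<in>C. l2_inner \<pi> f c *\<^sub>R (K *v c))"
    by (simp add: linear_sum[OF matrix_vector_mul_linear] linear_cmul[OF matrix_vector_mul_linear])
  also have "\<dots> = (\<Sum>c\<in>C. (\<mu> c * l2_inner \<pi> f c) *\<^sub>R c)"
    by (intro sum.cong) (simp_all add: eigen)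
  finally show ?thesis .
qed

text \<open>
  Comparing the coordinates of \<open>K f\<close> and \<open>t f\<close> shows that an eigenvector for \<open>t\<close> has zero
  coordinates at all basis vectors with another eigenvalue.
\<close>

lemma eigenspace_eq_span: "eigenspace K t = span {c\<in>C. \<mu> c = t}"
proof
  show "span {c\<in>C. \<mu> c = t} \<subseteq> eigenspace K t"
    by (rule span_minimal)
       (auto simp: eigenspace_def eigen subspace_def matrix_vector_right_distrib
          linear_cmul[OF matrix_vector_mul_linear] algebra_simps)
  show "eigenspace K t \<subseteq> span {c\<in>C. \<mu> c = t}"
  proof
    fix f assume "f \<in> eigenspace K t"
    then have "K *v f = t *\<^sub>R f" by (simp add: eigenspace_def)
    also have "\<dots> = (\<Sum>c\<in>C. (t * l2_inner \<pi> f c) *\<^sub>R c)"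
      by (subst expansion) (simp add: scaleR_sum_right)
    finally have "(\<Sum>c\<in>C. ((\<mu> c - t) * l2_inner \<pi> f c) *\<^sub>R c) = 0"
      by (simp add: mult_expansion algebra_simps sum_subtractf)
    then have coeff: "(\<mu> c - t) * l2_inner \<pi> f c = 0" if "c \<in> C" for c
      by (rule independentD[OF indep finite_basis subset_refl _ that])
    have "(\<Sum>c\<in>C. l2_inner \<pi> f c *\<^sub>R c) \<in> span {c\<in>C. \<mu> c = t}"
    proof (rule span_sum)
      fix c assume "c \<in> C"
      then show "l2_inner \<pi> f c *\<^sub>R c \<in> span {c\<in>C. \<mu> c = t}"
        using coeff[of c] by (cases "\<mu> c = t") (auto intro: span_scale span_base span_zero)
    qed
    then show "f \<in> span {c\<in>C. \<mu> c = t}" by (simp flip: expansion)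
  qed
qed

lemma dim_span_subset: "dim (span {c\<in>C. Q (\<mu> c)}) = card {c\<in>C. Q (\<mu> c)}"
  unfolding dim_span by (intro dim_eq_card_independent independent_mono[OF indep]) auto

lemma eigenvalues_eq: "eigenvalues K = \<mu> ` C"
proof -
  have "t \<in> eigenvalues K \<longleftrightarrow> \<not> eigenspace K t \<subseteq> {0}" for t
    by (auto simp: eigenvalues_def eigenspace_def)
  also have "\<not> eigenspace K t \<subseteq> {0} \<longleftrightarrow> {c\<in>C. \<mu> c = t} \<noteq> {}" for t
  proof -
    have "0 \<notin> C" using indep dependent_zero by blast
    moreover have "S = {} \<or> S = {0}" if "span S \<subseteq> {0}" for S :: "(real^'x) set"
      using that span_superset[of S] by auto
    ultimately show ?thesis
      unfolding eigenspace_eq_span by (metis (no_types, lifting) mem_Collect_eq order_refl singletonI span_empty)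
  qed
  finally show ?thesis by auto
qed

text \<open>
  The link between the definition of the eigenvalue list by dimensions of eigenspaces and
  the eigenbasis: statements about \<^term>\<open>ev K k\<close> become counts of basis vectors.
\<close>

lemma eigenvalue_list_eq:
  "eigenvalue_list K = rev (sorted_list_of_multiset (image_mset \<mu> (mset_set C)))"
proof -
  have "dim (eigenspace K t) = card {c\<in>C. \<mu> c = t}" for t
    unfolding eigenspace_eq_span by (rule dim_span_subset)
  then show ?thesis
    by (simp only: eigenvalue_list_def eigenvalues_eq sum_mset_replicate_fibres[OF finite_basis])
qed

lemma mset_eigenvalue_list: "mset (eigenvalue_list K) = image_mset \<mu> (mset_set C)"
  by (simp add: eigenvalue_list_eq)

lemma length_eigenvalue_list: "length (eigenvalue_list K) = CARD('x)"
  using arg_cong[OF mset_eigenvalue_list, of size] by (simp add: card_basis)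

lemma card_eq_length_filter:
  "card {c\<in>C. Q (\<mu> c)} = length (filter Q (eigenvalue_list K))"
proof -
  have "length (filter Q (eigenvalue_list K)) = size (filter_mset Q (mset (eigenvalue_list K)))"
    by (metis mset_filter size_mset)
  then show ?thesis
    using finite_basis by (simp add: mset_eigenvalue_list filter_mset_image_mset)
qed

lemma inner_self: "l2_inner \<pi> f f = (\<Sum>c\<in>C. (l2_inner \<pi> f c)\<^sup>2)"
proof -
  have "l2_inner \<pi> f f = l2_inner \<pi> (\<Sum>c\<in>C. l2_inner \<pi> f c *\<^sub>R c) f"
    by (rule arg_cong[where f = "\<lambda>h. l2_inner \<pi> h f", OF expansion])
  also have "\<dots> = (\<Sum>c\<in>C. l2_inner \<pi> f c * l2_inner \<pi> c f)"
    by (simp only: l2_inner_sum_left l2_inner_scaleR_left)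
  also have "\<dots> = (\<Sum>c\<in>C. (l2_inner \<pi> f c)\<^sup>2)"
    by (intro sum.cong refl) (metis power2_eq_square l2_inner_commute)
  finally show ?thesis .
qed

lemma form_eq: "l2_inner \<pi> (K *v f) f = (\<Sum>c\<in>C. \<mu> c * (l2_inner \<pi> f c)\<^sup>2)"
proof -
  have "l2_inner \<pi> (K *v f) f = (\<Sum>c\<in>C. \<mu> c * l2_inner \<pi> f c * l2_inner \<pi> c f)"
    by (simp only: mult_expansion l2_inner_sum_left l2_inner_scaleR_left)
  also have "\<dots> = (\<Sum>c\<in>C. \<mu> c * (l2_inner \<pi> f c)\<^sup>2)"
    by (intro sum.cong refl) (metis power2_eq_square l2_inner_commute mult.assoc)
  finally show ?thesis .
qed

lemma inner_eq_0_off_span: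
  assumes "f \<in> span {c\<in>C. Q (\<mu> c)}" "d \<in> C" "\<not> Q (\<mu> d)"
  shows "l2_inner \<pi> f d = 0"
  using assms(1)
proof (induction rule: span_induct_alt)
  case base
  show ?case by (simp add: l2_inner_def)
next
  case (step a c f)
  then have "l2_inner \<pi> c d = 0" using assms(2,3) by (auto simp: orthonormal)
  with step show ?case by (simp add: l2_inner_add_left l2_inner_scaleR_left)
qed

lemma form_ge:
  assumes "f \<in> span {c\<in>C. t \<le> \<mu> c}"
  shows "t * l2_inner \<pi> f f \<le> l2_inner \<pi> (K *v f) f"
  unfolding inner_self form_eq sum_distrib_left
proof (rule sum_mono)
  fix c assume "c \<in> C"
  then show "t * (l2_inner \<pi> f c)\<^sup>2 \<le> \<mu> c * (l2_inner \<pi> f c)\<^sup>2"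
    using inner_eq_0_off_span[OF assms, of c]
    by (cases "t \<le> \<mu> c") (auto intro: mult_right_mono)
qed

lemma form_le:
  assumes "f \<in> span {c\<in>C. \<mu> c \<le> t}"
  shows "l2_inner \<pi> (K *v f) f \<le> t * l2_inner \<pi> f f"
  unfolding inner_self form_eq sum_distrib_left
proof (rule sum_mono)
  fix c assume "c \<in> C"
  then show "\<mu> c * (l2_inner \<pi> f c)\<^sup>2 \<le> t * (l2_inner \<pi> f c)\<^sup>2"
    using inner_eq_0_off_span[OF assms, of c]
    by (cases "\<mu> c \<le> t") (auto intro: mult_right_mono)
qed

lemma ev_antimono:
  assumes "1 \<le> i" "i \<le> j" "j \<le> CARD('x)"
  shows "ev K j \<le> ev K i"
  unfolding ev_def
  using assms by (intro sorted_rev_nth_mono)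
    (simp_all add: eigenvalue_list_eq length_eigenvalue_list[unfolded eigenvalue_list_eq, simplified])

text \<open>
  The first \<open>k\<close> entries of the decreasing eigenvalue list are at least the \<open>k\<close>-th one. In the
  companion \<open>card_le_ev\<close> below, the entries from the \<open>k\<close>-th to the last are at most the \<open>k\<close>-th.
  With multiple eigenvalues both counts can be strictly larger.
\<close>

lemma card_ge_ev:
  assumes "k \<in> {1..CARD('x)}"
  shows "k \<le> card {c\<in>C. ev K k \<le> \<mu> c}"
proof -
  have "{..<k} \<subseteq> {i. i < length (eigenvalue_list K) \<and> ev K k \<le> eigenvalue_list K ! i}"
  proof clarify
    fix i assume "i < k"
    then show "i < length (eigenvalue_list K) \<and> ev K k \<le> eigenvalue_list K ! i"
      using assms ev_antimono[of "Suc i" k] by (auto simp: length_eigenvalue_list ev_def[of K "Suc i"])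
  qed
  from card_mono[OF _ this] show ?thesis
    by (simp add: card_eq_length_filter[of "\<lambda>s. ev K k \<le> s"] length_filter_conv_card)
qed

lemma card_le_ev:
  assumes "k \<in> {1..CARD('x)}"
  shows "CARD('x) + 1 - k \<le> card {c\<in>C. \<mu> c \<le> ev K k}"
proof -
  have "{k - 1..<CARD('x)} \<subseteq> {i. i < length (eigenvalue_list K) \<and> eigenvalue_list K ! i \<le> ev K k}"
  proof clarify
    fix i assume "i \<in> {k - 1..<CARD('x)}"
    then show "i < length (eigenvalue_list K) \<and> eigenvalue_list K ! i \<le> ev K k"
      using assms ev_antimono[of k "Suc i"] by (auto simp: length_eigenvalue_list ev_def[of K "Suc i"])
  qed
  from card_mono[OF _ this] show ?thesis
    using assms by (simp add: card_eq_length_filter[of "\<lambda>s. s \<le> ev K k"] length_filter_conv_card Suc_diff_le)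
qed

end

section \<open>Weyl's inequalities\<close>

lemma subspace_form_ge_ev:
  fixes K :: "real^'x^'x"
  assumes "\<And>x. \<pi> $ x > 0" "self_adjoint \<pi> K" "k \<in> {1..CARD('x)}"
  obtains V where "subspace V" "k \<le> dim V"
    "\<And>f. f \<in> V \<Longrightarrow> ev K k * l2_inner \<pi> f f \<le> l2_inner \<pi> (K *v f) f"
proof -
  obtain C \<mu> where "eigenbasis \<pi> K C \<mu>"
    using self_adjoint_eigenbasis[OF assms(1,2)] by blast
  then interpret eigenbasis \<pi> K C \<mu> .
  show ?thesis
    by (rule that[OF subspace_span _ form_ge])
      (simp_all only: dim_span_subset[of "\<lambda>s. ev K k \<le> s"] card_ge_ev[OF assms(3)])
qed

lemma subspace_form_le_ev:
  fixes K :: "real^'x^'x"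
  assumes "\<And>x. \<pi> $ x > 0" "self_adjoint \<pi> K" "k \<in> {1..CARD('x)}"
  obtains V where "subspace V" "CARD('x) + 1 - k \<le> dim V"
    "\<And>f. f \<in> V \<Longrightarrow> l2_inner \<pi> (K *v f) f \<le> ev K k * l2_inner \<pi> f f"
proof -
  obtain C \<mu> where "eigenbasis \<pi> K C \<mu>"
    using self_adjoint_eigenbasis[OF assms(1,2)] by blast
  then interpret eigenbasis \<pi> K C \<mu> .
  show ?thesis
    by (rule that[OF subspace_span _ form_le])
      (simp_all only: dim_span_subset[of "\<lambda>s. s \<le> ev K k"] card_le_ev[OF assms(3)])
qed

lemma subspaces_common_nonzero:
  fixes R S T :: "'a::euclidean_space set"
  assumes R: "subspace R" and S: "subspace S" and T: "subspace T"
    and big: "2 * DIM('a) < dim R + dim S + dim T"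
  obtains f where "f \<noteq> 0" "f \<in> R" "f \<in> S" "f \<in> T"
proof -
  have "dim R + dim S \<le> DIM('a) + dim (R \<inter> S)"
    using dim_sums_Int[OF R S] dim_subset_UNIV[of "{x + y |x y. x \<in> R \<and> y \<in> S}"] by linarith
  moreover have "dim (R \<inter> S) + dim T \<le> DIM('a) + dim (R \<inter> S \<inter> T)"
    using dim_sums_Int[OF subspace_inter[OF R S] T]
      dim_subset_UNIV[of "{x + y |x y. x \<in> R \<inter> S \<and> y \<in> T}"] by linarith
  ultimately have "dim (R \<inter> S \<inter> T) \<noteq> 0" using big by linarith
  then have "\<not> R \<inter> S \<inter> T \<subseteq> {0}" by (metis dim_eq_0)
  then show ?thesis using that by blast
qed

lemma self_adjoint_add: "self_adjoint \<pi> A \<Longrightarrow> self_adjoint \<pi> B \<Longrightarrow> self_adjoint \<pi> (A + B)"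
  unfolding self_adjoint_def matrix_vector_mult_add_rdistrib
  by (simp add: l2_inner_def algebra_simps sum.distrib)

text \<open>
  The subspaces where the forms of \<open>A\<close> and \<open>B\<close> are bounded above, and where that of \<open>A + B\<close> is
  bounded below, have total dimension at least
  \<open>(n + 1 - j) + (n + 1 - k) + (j + k - 1) = 2n + 1\<close>.
\<close>

theorem Weyl_upper:
  fixes A B :: "real^'x^'x"
  assumes pos: "\<And>x. \<pi> $ x > 0" and A: "self_adjoint \<pi> A" and B: "self_adjoint \<pi> B"
    and jk: "1 \<le> j" "1 \<le> k" "j + k \<le> CARD('x) + 1"
  shows "ev (A + B) (j + k - 1) \<le> ev A j + ev B k"
proof -
  have i: "j + k - 1 \<in> {1..CARD('x)}" using jk by auto
  obtain R where R: "subspace R" "CARD('x) + 1 - j \<le> dim R"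
    "\<And>f. f \<in> R \<Longrightarrow> l2_inner \<pi> (A *v f) f \<le> ev A j * l2_inner \<pi> f f"
    using subspace_form_le_ev[OF pos A, of j] jk by auto
  obtain S where S: "subspace S" "CARD('x) + 1 - k \<le> dim S"
    "\<And>f. f \<in> S \<Longrightarrow> l2_inner \<pi> (B *v f) f \<le> ev B k * l2_inner \<pi> f f"
    using subspace_form_le_ev[OF pos B, of k] jk by auto
  obtain T where T: "subspace T" "j + k - 1 \<le> dim T"
    "\<And>f. f \<in> T \<Longrightarrow> ev (A + B) (j + k - 1) * l2_inner \<pi> f f \<le> l2_inner \<pi> ((A + B) *v f) f"
    using subspace_form_ge_ev[OF pos self_adjoint_add[OF A B] i] by blast
  have "2 * DIM(real^'x) < dim R + dim S + dim T"
    using R(2) S(2) T(2) jk by simp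
  then obtain f where f: "f \<noteq> 0" "f \<in> R" "f \<in> S" "f \<in> T"
    using subspaces_common_nonzero[OF R(1) S(1) T(1)] by blast
  have "ev (A + B) (j + k - 1) * l2_inner \<pi> f f \<le> (ev A j + ev B k) * l2_inner \<pi> f f"
    using R(3)[OF f(2)] S(3)[OF f(3)] T(3)[OF f(4)]
    by (simp add: matrix_vector_mult_add_rdistrib l2_inner_add_left algebra_simps)
  then show ?thesis using l2_inner_pos[OF pos f(1)] by simp
qed

text \<open>
  The mirror image of \<open>Weyl_upper\<close>, with all bounds on the forms reversed; the total dimension
  is at least \<open>l + m + (n + 1 - (l + m - n)) = 2n + 1\<close>.
\<close>

theorem Weyl_lower:
  fixes A B :: "real^'x^'x"
  assumes pos: "\<And>x. \<pi> $ x > 0" and A: "self_adjoint \<pi> A" and B: "self_adjoint \<pi> B"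
    and lm: "l \<le> CARD('x)" "m \<le> CARD('x)" "CARD('x) + 1 \<le> l + m"
  shows "ev A l + ev B m \<le> ev (A + B) (l + m - CARD('x))"
proof -
  have i: "l + m - CARD('x) \<in> {1..CARD('x)}" using lm by auto
  obtain R where R: "subspace R" "l \<le> dim R"
    "\<And>f. f \<in> R \<Longrightarrow> ev A l * l2_inner \<pi> f f \<le> l2_inner \<pi> (A *v f) f"
    using subspace_form_ge_ev[OF pos A, of l] lm by auto
  obtain S where S: "subspace S" "m \<le> dim S"
    "\<And>f. f \<in> S \<Longrightarrow> ev B m * l2_inner \<pi> f f \<le> l2_inner \<pi> (B *v f) f"
    using subspace_form_ge_ev[OF pos B, of m] lm by auto
  obtain T where T: "subspace T" "CARD('x) + 1 - (l + m - CARD('x)) \<le> dim T"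
    "\<And>f. f \<in> T \<Longrightarrow> l2_inner \<pi> ((A + B) *v f) f \<le> ev (A + B) (l + m - CARD('x)) * l2_inner \<pi> f f"
    using subspace_form_le_ev[OF pos self_adjoint_add[OF A B] i] by blast
  have "2 * DIM(real^'x) < dim R + dim S + dim T"
    using R(2) S(2) T(2) lm by simp
  then obtain f where f: "f \<noteq> 0" "f \<in> R" "f \<in> S" "f \<in> T"
    using subspaces_common_nonzero[OF R(1) S(1) T(1)] by blast
  have "(ev A l + ev B m) * l2_inner \<pi> f f \<le> ev (A + B) (l + m - CARD('x)) * l2_inner \<pi> f f"
    using R(3)[OF f(2)] S(3)[OF f(3)] T(3)[OF f(4)]
    by (simp add: matrix_vector_mult_add_rdistrib l2_inner_add_left algebra_simps)
  then show ?thesis using l2_inner_pos[OF pos f(1)] by simp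
qed

section \<open>The spectral gap and the Metropolis-Hastings kernels\<close>

lemma eigenbasis_scaleR: "eigenbasis \<pi> K C \<mu> \<Longrightarrow> eigenbasis \<pi> (a *\<^sub>R K) C (\<lambda>c. a * \<mu> c)"
  by (auto simp: eigenbasis_def scaleR_matrix_vector_assoc[symmetric])

text \<open>
  A matrix and its multiple share an eigenbasis, and multiplying by a nonnegative number keeps
  the eigenvalues in order.
\<close>

lemma ev_scaleR:
  fixes K :: "real^'x^'x"
  assumes pos: "\<And>x. \<pi> $ x > 0" and sa: "self_adjoint \<pi> K" and a: "a \<ge> 0"
    and k: "k \<in> {1..CARD('x)}"
  shows "ev (a *\<^sub>R K) k = a * ev K k"
proof -
  obtain C \<mu> where K: "eigenbasis \<pi> K C \<mu>"
    using self_adjoint_eigenbasis[OF pos sa] by blast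
  interpret K: eigenbasis \<pi> K C \<mu> by (rule K)
  interpret aK: eigenbasis \<pi> "a *\<^sub>R K" C "\<lambda>c. a * \<mu> c" by (rule eigenbasis_scaleR[OF K])
  have "sorted (map ((*) a) (rev (eigenvalue_list K)))"
    using a by (auto simp: K.eigenvalue_list_eq intro!: sorted_map_mono mono_onI mult_left_mono)
  moreover have "mset (map ((*) a) (rev (eigenvalue_list K))) = mset (rev (eigenvalue_list (a *\<^sub>R K)))"
    by (simp add: K.mset_eigenvalue_list aK.mset_eigenvalue_list image_mset.compositionality o_def)
  ultimately have "sort (rev (eigenvalue_list (a *\<^sub>R K))) = map ((*) a) (rev (eigenvalue_list K))"
    by (intro properties_for_sort)
  moreover have "sort (rev (eigenvalue_list (a *\<^sub>R K))) = rev (eigenvalue_list (a *\<^sub>R K))"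
    by (intro sorted_sort_id) (simp add: aK.eigenvalue_list_eq)
  ultimately have "map ((*) a) (rev (eigenvalue_list K)) = rev (eigenvalue_list (a *\<^sub>R K))"
    by simp
  then have "eigenvalue_list (a *\<^sub>R K) = map ((*) a) (eigenvalue_list K)"
    by (metis rev_map rev_rev_ident)
  then show ?thesis
    using k by (auto simp: ev_def K.length_eigenvalue_list nth_map)
qed

lemma MH1_add_MH2:
  assumes "\<And>x. \<pi> $ x > 0"
  shows "MH1 \<pi> P + MH2 \<pi> P = 2 *\<^sub>R additive_reversibilization \<pi> P"
proof -
  have "\<pi> $ x \<noteq> 0" for x using assms[of x] by simp
  then show ?thesis
    by (auto simp: vec_eq_iff MH1_def MH2_def additive_reversibilization_def time_reversal_def)
qed


theorem corollary3p2:
  fixes P :: "real^'x^'x" and \<pi> :: "real^'x" and n :: nat and L U :: real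
  assumes "n = CARD('x)" and "n \<ge> 2"
    and "stochastic P" and "irreducible_chain P"
    and "stationary_distribution \<pi> P" and "\<forall>x. \<pi> $ x > 0"
    and "L = Max {ev (MH1 \<pi> P) l + ev (MH2 \<pi> P) m | l m.
                    l \<in> {1..n} \<and> m \<in> {1..n} \<and> l + m = 2 + n}"
    and "U = Min {ev (MH1 \<pi> P) j + ev (MH2 \<pi> P) k | j k.
                    j \<in> {1..n} \<and> k \<in> {1..n} \<and> j + k = 3}"
  shows "1 - U / 2 \<le> spectral_gap \<pi> P \<and> spectral_gap \<pi> P \<le> 1 - L / 2"
proof -
  let ?M1 = "MH1 \<pi> P" and ?M2 = "MH2 \<pi> P" and ?A = "additive_reversibilization \<pi> P"
  have pos: "\<pi> $ x > 0" for x using assms(6) by blast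
  note sa = self_adjoint_kernels[OF pos, of P]
  have sum2: "ev (?M1 + ?M2) 2 = 2 * ev ?A 2"
    unfolding MH1_add_MH2[OF pos] by (rule ev_scaleR[OF pos sa(3)]) (use assms(1,2) in auto)
  let ?LS = "{ev ?M1 l + ev ?M2 m | l m. l \<in> {1..n} \<and> m \<in> {1..n} \<and> l + m = 2 + n}"
  let ?US = "{ev ?M1 j + ev ?M2 k | j k. j \<in> {1..n} \<and> k \<in> {1..n} \<and> j + k = 3}"
  have fin: "finite {f l m | l m. l \<in> {1..n} \<and> m \<in> {1..n} \<and> l + m = s}" for f :: "nat \<Rightarrow> nat \<Rightarrow> real" and s
    by (rule finite_subset[of _ "(\<lambda>(l, m). f l m) ` ({1..n} \<times> {1..n})"]) auto
  have "?LS \<noteq> {}"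
  proof -
    have "ev ?M1 2 + ev ?M2 n \<in> ?LS" using assms(2) by force
    then show ?thesis by blast
  qed
  then have "L \<in> ?LS"
    unfolding assms(7) by (intro Max_in fin)
  then obtain l m where "L = ev ?M1 l + ev ?M2 m" "l \<le> n" "m \<le> n" "l + m = 2 + n" by auto
  then have L: "L \<le> 2 * ev ?A 2"
    using Weyl_lower[OF pos sa(1,2), of l m] assms(1) by (simp add: sum2)
  have "?US \<noteq> {}"
  proof -
    have "ev ?M1 1 + ev ?M2 2 \<in> ?US" using assms(2) by force
    then show ?thesis by blast
  qed
  then have "U \<in> ?US"
    unfolding assms(8) by (intro Min_in fin)
  then obtain j k where "U = ev ?M1 j + ev ?M2 k" "1 \<le> j" "1 \<le> k" "j + k = 3" by auto
  then have U: "2 * ev ?A 2 \<le> U"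
    using Weyl_upper[OF pos sa(1,2), of j k] assms(1,2) by (simp add: sum2)
  from L U show ?thesis by (simp add: spectral_gap_def)
qed

end
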